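(* Let $n\ge 1$ and let $T$ be a triangulation of the grid-covered cylinder graph $G_{3,n}$ (three sectors). Then $T$ is word-representable if and only if $T$ contains none of the following six graphs $H_1,\dots,H_6$ as an induced subgraph: $H_1$: vertices $1,\dots,7$, edges $12,13,14,15,25,34,35,36,45,47,56,57,67$; $H_2$: vertices $1,\dots,7$, edges $12,13,14,15,23,25,26,34,36,45,46,47,56,57,67$; $H_3$: vertices $1,\dots,8$, edges $12,14,23,24,25,26,27,34,36,37,47,56,57,67,68,78$; $H_4$: vertices $1,\dots,8$, edges $12,13,14,23,24,25,26,27,34,36,37,47,56,57,58,67,78$; $H_5$: vertices $1,\dots,8$, edges $12,13,14,15,24,25,34,35,36,38,45,46,47,48,58,67,68,78$; $H_6$: vertices $1,\dots,8$, edges $12,14,15,23,25,34,35,36,37,45,46,47,57,67,68,78$.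
   Context: A simple graph $G=(V,E)$ is word-representable if there is a word $w$ over $V$, containing every letter of $V$, such that for distinct $x,y\in V$, $x$ and $y$ alternate in $w$ if and only if $xy\in E$. The grid-covered cylinder graph $G_{m,n}$ has vertex set $\{v_{ij}: 0\le i\le n,\ 0\le j\le m-1\}$, horizontal edges $v_{ij}v_{i,j+1}$ (second index mod $m$) and vertical edges $v_{ij}v_{i+1,j}$ ($0\le i\le n-1$). Its cells are the $mn$ 4-cycles $v_{ij}v_{i+1,j}v_{i+1,j+1}v_{i,j+1}$ (second index mod $m$). A triangulation of $G_{m,n}$ is obtained by adding, in each cell, exactly one of its two diagonals as an edge. In the edge lists, $ab$ denotes the edge between vertices $a$ and $b$. *)

theory Defs
  imports Main
begin

type_synonym 'a graph = "'a set \<times> 'a set set"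

abbreviation verts :: "'a graph \<Rightarrow> 'a set" where
  "verts G \<equiv> fst G"

abbreviation edges :: "'a graph \<Rightarrow> 'a set set" where
  "edges G \<equiv> snd G"

definition simple_graph :: "'a graph \<Rightarrow> bool" where
  "simple_graph G \<longleftrightarrow> (\<forall>e \<in> edges G. e \<subseteq> verts G \<and> card e = 2)"

definition induced_subgraph :: "'a graph \<Rightarrow> 'a set \<Rightarrow> 'a graph" where
  "induced_subgraph G S = (S, {e \<in> edges G. e \<subseteq> S})"

definition graph_isomorphic :: "'a graph \<Rightarrow> 'b graph \<Rightarrow> bool" where
  "graph_isomorphic G H \<longleftrightarrow>
     (\<exists>f. bij_betw f (verts G) (verts H) \<and>
          (\<forall>x \<in> verts G. \<forall>y \<in> verts G. {x, y} \<in> edges G \<longleftrightarrow> {f x, f y} \<in> edges H))"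

definition contains_induced :: "'a graph \<Rightarrow> 'b graph \<Rightarrow> bool" where
  "contains_induced G H \<longleftrightarrow>
     (\<exists>S \<subseteq> verts G. graph_isomorphic H (induced_subgraph G S))"

(* Two letters alternate in a word if deleting all other letters leaves a word
   xyxy... or yxyx..., i.e. one without two equal neighbouring letters. *)
definition alternate :: "'a \<Rightarrow> 'a \<Rightarrow> 'a list \<Rightarrow> bool" where
  "alternate x y w \<longleftrightarrow> distinct_adj (filter (\<lambda>z. z = x \<or> z = y) w)"

definition word_representable :: "'a graph \<Rightarrow> bool" where
  "word_representable G \<longleftrightarrow>
     (\<exists>w. set w = verts G \<and>
          (\<forall>x \<in> verts G. \<forall>y \<in> verts G. x \<noteq> y \<longrightarrow>
             (alternate x y w \<longleftrightarrow> {x, y} \<in> edges G)))"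

(* The vertex v_{ij} is the pair (i, j). *)
definition cylinder_graph :: "nat \<Rightarrow> nat \<Rightarrow> (nat \<times> nat) graph" where
  "cylinder_graph m n =
     ({0..n} \<times> {0..<m},
      {{(i, j), (i, (j + 1) mod m)} | i j. i \<le> n \<and> j < m} \<union>
      {{(i, j), (i + 1, j)} | i j. i < n \<and> j < m})"

(* The two diagonals of the cell v_{i,j} v_{i+1,j} v_{i+1,j+1} v_{i,j+1}. *)
definition cell_diagonals :: "nat \<Rightarrow> nat \<Rightarrow> nat \<Rightarrow> (nat \<times> nat) set set" where
  "cell_diagonals m i j =
     {{(i, j), (i + 1, (j + 1) mod m)}, {(i + 1, j), (i, (j + 1) mod m)}}"

definition cylinder_triangulation :: "nat \<Rightarrow> nat \<Rightarrow> (nat \<times> nat) graph \<Rightarrow> bool" where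
  "cylinder_triangulation m n T \<longleftrightarrow>
     (\<exists>d. (\<forall>i < n. \<forall>j < m. d i j \<in> cell_diagonals m i j) \<and>
          T = (verts (cylinder_graph m n),
               edges (cylinder_graph m n) \<union> {d i j | i j. i < n \<and> j < m}))"

definition graph_of_list :: "nat \<Rightarrow> (nat \<times> nat) list \<Rightarrow> nat graph" where
  "graph_of_list k ps = ({1..k}, {{a, b} | a b. (a, b) \<in> set ps})"

definition H1 :: "nat graph" where
  "H1 = graph_of_list 7
     [(1,2), (1,3), (1,4), (1,5), (2,5), (3,4), (3,5), (3,6), (4,5),
      (4,7), (5,6), (5,7), (6,7)]"

definition H2 :: "nat graph" where
  "H2 = graph_of_list 7
     [(1,2), (1,3), (1,4), (1,5), (2,3), (2,5), (2,6), (3,4), (3,6),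
      (4,5), (4,6), (4,7), (5,6), (5,7), (6,7)]"

definition H3 :: "nat graph" where
  "H3 = graph_of_list 8
     [(1,2), (1,4), (2,3), (2,4), (2,5), (2,6), (2,7), (3,4), (3,6),
      (3,7), (4,7), (5,6), (5,7), (6,7), (6,8), (7,8)]"

definition H4 :: "nat graph" where
  "H4 = graph_of_list 8
     [(1,2), (1,3), (1,4), (2,3), (2,4), (2,5), (2,6), (2,7), (3,4),
      (3,6), (3,7), (4,7), (5,6), (5,7), (5,8), (6,7), (7,8)]"

definition H5 :: "nat graph" where
  "H5 = graph_of_list 8
     [(1,2), (1,3), (1,4), (1,5), (2,4), (2,5), (3,4), (3,5), (3,6),
      (3,8), (4,5), (4,6), (4,7), (4,8), (5,8), (6,7), (6,8), (7,8)]"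

definition H6 :: "nat graph" where
  "H6 = graph_of_list 8
     [(1,2), (1,4), (1,5), (2,3), (2,5), (3,4), (3,5), (3,6), (3,7),
      (4,5), (4,6), (4,7), (5,7), (6,7), (6,8), (7,8)]"

lemma simple_graph_forbidden:
  assumes "H \<in> {H1, H2, H3, H4, H5, H6}"
  shows "simple_graph H"
  using assms
  by (auto simp: simple_graph_def graph_of_list_def H1_def H2_def H3_def H4_def H5_def H6_def)

lemma simple_graph_cylinder_triangulation:
  assumes "m \<ge> 3" "cylinder_triangulation m n T"
  shows "simple_graph T"
proof -
  have neq: "(j + 1) mod m \<noteq> j" if "j < m" for j
    using that assms(1) by (cases "j + 1 = m") auto
  have lt: "(j + 1) mod m < m" for j
    using assms(1) by simp
  obtain d where d: "\<And>i j. i < n \<Longrightarrow> j < m \<Longrightarrow> d i j \<in> cell_diagonals m i j"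
    and T: "T = (verts (cylinder_graph m n),
               edges (cylinder_graph m n) \<union> {d i j | i j. i < n \<and> j < m})"
    using assms(2) unfolding cylinder_triangulation_def by blast
  have "e \<subseteq> verts (cylinder_graph m n) \<and> card e = 2" if "e \<in> edges (cylinder_graph m n)" for e
    using that neq lt by (fastforce simp: cylinder_graph_def card_2_iff doubleton_eq_iff)
  moreover have "d i j \<subseteq> verts (cylinder_graph m n) \<and> card (d i j) = 2" if "i < n" "j < m" for i j
    using d[OF that] that lt[of j] by (auto simp: cell_diagonals_def cylinder_graph_def)
  ultimately show ?thesis
    unfolding simple_graph_def T by auto
qed

end

theory Submission
  imports Defs
begin

text \<open>
  A finite graph is word-representable iff its vertices admit a strict partial order in which
  adjacent vertices are comparable and every vertex strictly between two adjacent vertices is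
  adjacent to both (the reachability order of a semi-transitive orientation). From a word one takes
  the pointwise order of the prefix counts of the letters.

  In such an order a 4-cycle that is not a clique has exactly two arcs in each direction; for each
  of the six graphs a handful of 4-cycles already makes these conditions contradictory.

  For the converse, a layer of the cylinder with three equal diagonals is an antiprism; in every other
  layer the adjacency between the two rows is a half graph \<open>rk a \<le> rk c\<close>. Unless two
  consecutive layers are both antiprisms or carry the same half graph up to reversal, they
  contain \<open>H1\<close>, \<open>H4\<close> or \<open>H5\<close>. A stack of antiprisms is 3-colourable, and in a stack of half graphs
  the product of the column order with an order of the rows does the job.
\<close>

section \<open>Word-representability and convex orders\<close>

text \<open>The last clause is the absence of shortcuts: if \<open>x z\<close> is an edge and
  \<open>P x u\<close>, \<open>P u v\<close>, \<open>P v z\<close>, then \<open>x v\<close> is an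
  edge, and applying the clause to \<open>x v\<close> makes \<open>u v\<close> an edge too.\<close>

definition convex_order :: "'a graph \<Rightarrow> ('a \<Rightarrow> 'a \<Rightarrow> bool) \<Rightarrow> bool" where
  "convex_order G P \<longleftrightarrow>
     (\<forall>x \<in> verts G. \<not> P x x) \<and>
     (\<forall>x \<in> verts G. \<forall>y \<in> verts G. \<forall>z \<in> verts G. P x y \<longrightarrow> P y z \<longrightarrow> P x z) \<and>
     (\<forall>x \<in> verts G. \<forall>y \<in> verts G. x \<noteq> y \<longrightarrow> {x, y} \<in> edges G \<longrightarrow> P x y \<or> P y x) \<and>
     (\<forall>x \<in> verts G. \<forall>y \<in> verts G. \<forall>z \<in> verts G.
        {x, z} \<in> edges G \<longrightarrow> P x y \<longrightarrow> P y z \<longrightarrow> {x, y} \<in> edges G \<and> {y, z} \<in> edges G)"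

lemma convex_orderI:
  assumes "\<And>x. x \<in> verts G \<Longrightarrow> \<not> P x x"
    and "\<And>x y z. \<lbrakk>x \<in> verts G; y \<in> verts G; z \<in> verts G; P x y; P y z\<rbrakk> \<Longrightarrow> P x z"
    and "\<And>x y. \<lbrakk>x \<in> verts G; y \<in> verts G; x \<noteq> y; {x, y} \<in> edges G\<rbrakk> \<Longrightarrow> P x y \<or> P y x"
    and "\<And>x y z. \<lbrakk>x \<in> verts G; y \<in> verts G; z \<in> verts G; {x, z} \<in> edges G; P x y; P y z\<rbrakk>
      \<Longrightarrow> {x, y} \<in> edges G \<and> {y, z} \<in> edges G"
  shows "convex_order G P"
  using assms unfolding convex_order_def by blast

lemma convex_orderD:
  assumes "convex_order G P"
  shows "x \<in> verts G \<Longrightarrow> \<not> P x x"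
    and "\<lbrakk>x \<in> verts G; y \<in> verts G; z \<in> verts G; P x y; P y z\<rbrakk> \<Longrightarrow> P x z"
    and "\<lbrakk>x \<in> verts G; y \<in> verts G; x \<noteq> y; {x, y} \<in> edges G\<rbrakk> \<Longrightarrow> P x y \<or> P y x"
    and "\<lbrakk>x \<in> verts G; y \<in> verts G; z \<in> verts G; {x, z} \<in> edges G; P x y; P y z\<rbrakk>
      \<Longrightarrow> {x, y} \<in> edges G \<and> {y, z} \<in> edges G"
  using assms unfolding convex_order_def by blast+

section \<open>Alternation and prefix counts\<close>

text \<open>Induction on the word, with \<open>x\<close> and \<open>y\<close> generalised: reading
  \<open>x\<close> exchanges their roles, since the rest must then start with \<open>y\<close>; a
  leading \<open>y\<close> already violates the count condition.\<close>

lemma alternate_starting_iff: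
  assumes "x \<noteq> y"
  shows "(\<forall>k. count_list (take k w) y \<le> count_list (take k w) x \<and>
              count_list (take k w) x \<le> Suc (count_list (take k w) y)) \<longleftrightarrow>
         alternate x y w \<and> (filter (\<lambda>z. z = x \<or> z = y) w = [] \<or> hd (filter (\<lambda>z. z = x \<or> z = y) w) = x)"
  using assms
proof (induction w arbitrary: x y)
  case Nil
  then show ?case by (simp add: alternate_def)
next
  case (Cons z w)
  let ?ok = "\<lambda>x y w. \<forall>k. count_list (take k w) y \<le> count_list (take k w) x \<and>
              count_list (take k w) x \<le> Suc (count_list (take k w) y)"
  let ?f = "\<lambda>x y w. filter (\<lambda>z. z = x \<or> z = y) w"
  \<comment> \<open>Separates the empty prefix, so that a condition on the prefixes of
    \<open>z # w\<close> becomes one on those of \<open>w\<close> with \<open>z\<close>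
    prepended.\<close>
  have all_take: "(\<forall>k. Q (take k (z # w))) \<longleftrightarrow> Q [] \<and> (\<forall>k. Q (z # take k w))" for Q
    by (metis take_0 take_Suc_Cons not0_implies_Suc)
  have swap: "?f x y w = ?f y x w" by (rule filter_cong) auto
  consider "z = x" | "z = y" | "z \<noteq> x" "z \<noteq> y" by blast
  then show ?case
  proof cases
    case 1
    have "?ok x y (z # w) \<longleftrightarrow> ?ok y x w"
      using 1 Cons.prems by (subst all_take) auto
    also have "\<dots> \<longleftrightarrow> alternate y x w \<and> (?f y x w = [] \<or> hd (?f y x w) = y)"
      using Cons.IH[OF Cons.prems[symmetric]] .
    also have "\<dots> \<longleftrightarrow> alternate x y (z # w)"
    proof -
      have "?f y x w = [] \<or> hd (?f y x w) = y \<or> hd (?f y x w) = x"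
        using hd_in_set[of "?f y x w"] by auto
      then show ?thesis
        using 1 Cons.prems swap by (auto simp: alternate_def distinct_adj_Cons)
    qed
    finally show ?thesis using 1 by simp
  next
    case 2
    then have "\<not> ?ok x y (z # w)"
      using Cons.prems by (subst all_take) (auto intro!: exI[of _ 0])
    then show ?thesis using 2 Cons.prems by simp
  next
    case 3
    have "?ok x y (z # w) \<longleftrightarrow> ?ok x y w"
      using 3 by (subst all_take) auto
    then show ?thesis using 3 Cons by (simp add: alternate_def)
  qed
qed

lemma alternate_commute: "alternate x y w \<longleftrightarrow> alternate y x w"
  unfolding alternate_def by (simp add: disj_commute)

text \<open>The restricted word is empty or starts with \<open>x\<close> or with \<open>y\<close>,
  which yields the two symmetric cases.\<close>

lemma alternate_iff:
  assumes "x \<noteq> y"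
  shows "alternate x y w \<longleftrightarrow>
    (\<forall>k. count_list (take k w) y \<le> count_list (take k w) x \<and>
         count_list (take k w) x \<le> Suc (count_list (take k w) y)) \<or>
    (\<forall>k. count_list (take k w) x \<le> count_list (take k w) y \<and>
         count_list (take k w) y \<le> Suc (count_list (take k w) x))"
proof -
  let ?f = "filter (\<lambda>z. z = x \<or> z = y) w"
  have swap: "filter (\<lambda>z. z = y \<or> z = x) w = ?f" by (rule filter_cong) auto
  have "?f \<noteq> [] \<Longrightarrow> hd ?f = x \<or> hd ?f = y"
    using hd_in_set[of ?f] by auto
  then show ?thesis
    unfolding alternate_starting_iff[OF assms] alternate_starting_iff[OF assms[symmetric]] swap
    using alternate_commute[of x y w] by blast
qed

text \<open>Gives antisymmetry of the order by prefix counts: the prefix ending at the first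
  \<open>x\<close> raises the count of \<open>x\<close> and of no other letter.\<close>

lemma count_list_take_eq_imp_eq:
  assumes "x \<in> set w" and "\<And>k. count_list (take k w) x = count_list (take k w) y"
  shows "x = y"
proof (rule ccontr)
  assume "x \<noteq> y"
  obtain us vs where w: "w = us @ x # vs" and "x \<notin> set us"
    using split_list_first[OF assms(1)] by blast
  have "count_list (take (Suc (length us)) w) x = Suc (count_list us x)"
    "count_list (take (Suc (length us)) w) y = count_list us y"
    using \<open>x \<noteq> y\<close> by (simp_all add: w)
  moreover have "count_list us x = count_list us y"
    using assms(2)[of "length us"] by (simp add: w)
  ultimately show False
    using assms(2)[of "Suc (length us)"] by simp
qed

text \<open>Adjacent letters have comparable counts that never differ by more than 1. Counts
  squeezed between those of two adjacent letters obey the same bound, hence the last clause of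
  convexity.\<close>

lemma word_representable_imp_convex_order:
  assumes "word_representable G"
  shows "\<exists>P. convex_order G P"
proof -
  obtain w where set: "set w = verts G"
    and w: "\<And>x y. x \<in> verts G \<Longrightarrow> y \<in> verts G \<Longrightarrow> x \<noteq> y \<Longrightarrow>
      alternate x y w \<longleftrightarrow> {x, y} \<in> edges G"
    using assms unfolding word_representable_def by blast
  define c where "c k x = count_list (take k w) x" for k x
  define P where "P x y \<longleftrightarrow> x \<noteq> y \<and> (\<forall>k. c k y \<le> c k x)" for x y
  have edge: "{x, y} \<in> edges G \<longleftrightarrow>
      (\<forall>k. c k y \<le> c k x \<and> c k x \<le> Suc (c k y)) \<or> (\<forall>k. c k x \<le> c k y \<and> c k y \<le> Suc (c k x))"
    if "x \<in> verts G" "y \<in> verts G" "x \<noteq> y" for x y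
    using w[OF that] alternate_iff[OF that(3)] unfolding c_def by blast
  have antisym: "x = y" if "x \<in> verts G" "\<forall>k. c k y \<le> c k x" "\<forall>k. c k x \<le> c k y" for x y
    using count_list_take_eq_imp_eq[of x w y] that set unfolding c_def
    by (metis le_antisym)
  have "convex_order G P"
  proof (rule convex_orderI)
    show "\<not> P x x" for x by (simp add: P_def)
  next
    fix x y z assume "x \<in> verts G" "y \<in> verts G" "z \<in> verts G" "P x y" "P y z"
    then show "P x z"
      unfolding P_def by (metis antisym le_trans)
  next
    fix x y assume "x \<in> verts G" "y \<in> verts G" "x \<noteq> y" "{x, y} \<in> edges G"
    then show "P x y \<or> P y x"
      using edge[of x y] unfolding P_def by blast
  next
    fix x y z
    assume V: "x \<in> verts G" "y \<in> verts G" "z \<in> verts G" and e: "{x, z} \<in> edges G"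
      and P: "P x y" "P y z"
    have "x \<noteq> z" using P antisym V unfolding P_def by blast
    moreover have le: "c k z \<le> c k y" "c k y \<le> c k x" for k using P unfolding P_def by auto
    ultimately have "c k x \<le> Suc (c k z)" for k
      using edge[of x z] e V by (metis le_SucI le_trans order.refl)
    then have "c k x \<le> Suc (c k y)" "c k y \<le> Suc (c k z)" for k
      using le by (meson le_trans Suc_le_mono)+
    then show "{x, y} \<in> edges G \<and> {y, z} \<in> edges G"
      using edge[of x y] edge[of y z] V P le unfolding P_def by blast
  qed
  then show ?thesis by blast
qed

section \<open>From convex orders to words\<close>

text \<open>A minimal element is put first and removed, repeatedly. The list fixes the order of the
  letters inside each block of the words below.\<close>

lemma linear_extension_list:
  assumes "finite V" and "\<And>x. x \<in> V \<Longrightarrow> \<not> P x x"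
    and "\<And>x y z. \<lbrakk>x \<in> V; y \<in> V; z \<in> V; P x y; P y z\<rbrakk> \<Longrightarrow> P x z"
  shows "\<exists>L. set L = V \<and> distinct L \<and> sorted_wrt (\<lambda>x y. \<not> P y x) L"
  using assms
proof (induction V rule: finite_remove_induct)
  case empty
  then show ?case by simp
next
  case (remove V)
  have "asymp_on V P" "transp_on V P"
    using remove.prems by (auto intro!: asymp_onI transp_onI)
  then obtain m where m: "m \<in> V" "\<forall>x \<in> V. x \<noteq> m \<longrightarrow> \<not> P x m"
    using Finite_Set.bex_min_element[of V P] remove.hyps by blast
  obtain L where "set L = V - {m}" "distinct L" "sorted_wrt (\<lambda>x y. \<not> P y x) L"
    using remove.IH[OF m(1)] remove.prems by blast
  then show ?case
    using m by (intro exI[of _ "m # L"]) auto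
qed

lemma distinct_set_doubleton:
  assumes "distinct xs" "set xs = {x, y}" "x \<noteq> y"
  shows "xs = [x, y] \<or> xs = [y, x]"
proof -
  have "length xs = 2" using assms distinct_card[of xs] by simp
  then obtain a b where "xs = [a, b]"
    by (auto simp: numeral_2_eq_2 length_Suc_conv)
  then show ?thesis using assms by (auto simp: doubleton_eq_iff)
qed

lemma distinct_adj_concat_map:
  assumes "\<And>v. v \<in> set vs \<Longrightarrow> f v = [x, y, x, y]" and "x \<noteq> y"
  shows "distinct_adj (concat (map f vs))"
proof -
  \<comment> \<open>The induction carries the head along: every block ends in \<open>y\<close>, so
    whatever follows must start with \<open>x\<close>.\<close>
  have "distinct_adj (concat (map f vs)) \<and> (concat (map f vs) = [] \<or> hd (concat (map f vs)) = x)"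
    using assms(1)
  proof (induction vs)
    case (Cons v vs)
    then show ?case using assms(2) by (auto simp: distinct_adj_Cons)
  qed simp
  then show ?thesis ..
qed

text \<open>
  The words \<open>A I T A v O I v B T O B\<close> below are those of Halldorsson, Kitaev and Pyatkin: each
  of them preserves the alternation of all edges and destroys that of the non-edges at \<open>v\<close>.
\<close>
lemma convex_order_imp_word_representable:
  assumes fin: "finite (verts G)" and co: "convex_order G P"
  shows "word_representable G"
proof -
  define V where "V = verts G"
  define E where "E x y \<longleftrightarrow> {x, y} \<in> edges G" for x y
  have irrefl: "\<And>x. x \<in> V \<Longrightarrow> \<not> P x x"
    and trans: "\<And>x y z. \<lbrakk>x \<in> V; y \<in> V; z \<in> V; P x y; P y z\<rbrakk> \<Longrightarrow> P x z"
    and comp: "\<And>x y. \<lbrakk>x \<in> V; y \<in> V; x \<noteq> y; E x y\<rbrakk> \<Longrightarrow> P x y \<or> P y x"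
    and conv: "\<And>x y z. \<lbrakk>x \<in> V; y \<in> V; z \<in> V; E x z; P x y; P y z\<rbrakk> \<Longrightarrow> E x y \<and> E y z"
    using convex_orderD[OF co] unfolding V_def E_def by blast+
  have sym: "E x y \<longleftrightarrow> E y x" for x y
    unfolding E_def by (simp add: insert_commute)
  obtain L where L: "set L = V" "distinct L" "sorted_wrt (\<lambda>x y. \<not> P y x) L"
    using linear_extension_list[of V P] fin irrefl trans unfolding V_def by blast
  \<comment> \<open>Relative to \<open>v\<close> the other letters split into in-neighbours
    \<open>I\<close>, nonadjacent predecessors \<open>A\<close>, out-neighbours \<open>O'\<close>,
    nonadjacent successors \<open>B\<close> and incomparable letters \<open>T\<close>. Each class,
    and \<open>v\<close> itself, appears twice in \<open>blocks v\<close>, so \<open>W v L\<close>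
    contains every letter twice.\<close>
  define I where "I v u \<longleftrightarrow> P u v \<and> E u v" for u v
  define A where "A v u \<longleftrightarrow> P u v \<and> \<not> E u v" for u v
  define O' where "O' v u \<longleftrightarrow> P v u \<and> E u v" for u v
  define B where "B v u \<longleftrightarrow> P v u \<and> \<not> E u v" for u v
  define T where "T v u \<longleftrightarrow> u \<noteq> v \<and> \<not> P u v \<and> \<not> P v u" for u v
  define blocks where "blocks v = [A v, I v, T v, A v, (=) v, O' v, I v, (=) v, B v, T v, O' v, B v]" for v
  define W where "W v l = concat (map (\<lambda>S. filter S l) (blocks v))" for v l
  define f where "f x y = filter (\<lambda>z. z = x \<or> z = y)" for x y :: 'a
  have f_L: "f x y L = [x, y] \<or> f x y L = [y, x]" if "x \<in> V" "y \<in> V" "x \<noteq> y" for x y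
    using distinct_set_doubleton[of "f x y L" x y] L that unfolding f_def by auto
  \<comment> \<open>Restriction to two letters commutes with \<open>W\<close>, so only the words
    \<open>W v [x, y]\<close> and \<open>W v [y, x]\<close> have to be examined.\<close>
  have f_W: "f x y (W v l) = W v (f x y l)" for x y v l
    unfolding W_def f_def blocks_def by (simp add: filter_filter conj_commute)
  have f_concat: "f x y (concat xss) = concat (map (f x y) xss)" for x y xss
    unfolding f_def by (induction xss) auto
  have edge_block: "f x y (W v L) = [x, y, x, y]"
    if V: "x \<in> V" "y \<in> V" "v \<in> V" and E: "E x y" and P: "P x y" for x y v
  proof -
    have ne: "x \<noteq> y" using irrefl P V by blast
    have "sorted_wrt (\<lambda>x y. \<not> P y x) (f x y L)"
      using L(3) unfolding f_def by (rule sorted_wrt_filter)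
    then have "f x y L = [x, y]"
      using f_L[OF V(1,2) ne] P by auto
    moreover have "W v [x, y] = [x, y, x, y]"
    proof -
      have ir: "\<not> P x x" "\<not> P y y" "\<not> P v v" using irrefl V by auto
      have tr: "P v x \<longrightarrow> P v y" "P y v \<longrightarrow> P x v" "\<not> P y x" "\<not> (P x v \<and> P v x)" "\<not> (P y v \<and> P v y)"
        using trans[of v x y] trans[of x y v] trans[of y x y] trans[of x v x] trans[of y v y] V P ir by auto
      \<comment> \<open>Convexity for the three positions of \<open>v\<close>: between
        \<open>x\<close> and \<open>y\<close>, before both, after both. It excludes the placements
        of \<open>x\<close> and \<open>y\<close> in classes that would break the pattern.\<close>
      have cv: "P x v \<and> P v y \<longrightarrow> E x v \<and> E y v"
        "P v x \<and> E y v \<longrightarrow> E x v" "P y v \<and> E x v \<longrightarrow> E y v"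
        using conv[of x v y] conv[of v x y] conv[of x y v] V P E sym[of x v] sym[of y v] by auto
      have E': "E y x" using E sym by blast
      note defs = W_def blocks_def A_def I_def O'_def B_def T_def
      consider "x = v" | "y = v" | "x \<noteq> v" "y \<noteq> v" by blast
      then show ?thesis
      proof cases
        case 1
        then show ?thesis using ir tr ne E' P unfolding defs by simp
      next
        case 2
        then show ?thesis using ir tr ne E P unfolding defs by simp
      next
        case 3
        then show ?thesis
          unfolding defs using tr cv
          by (cases "P x v"; cases "P y v"; cases "P v x"; cases "P v y";
              cases "E x v"; cases "E y v") simp_all
      qed
    qed
    ultimately show ?thesis by (simp add: f_W)
  qed
  have edge: "distinct_adj (f x y (concat (map (\<lambda>v. W v L) L)))"
    if "x \<in> V" "y \<in> V" "E x y" "P x y" for x y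
    unfolding f_concat map_map comp_def
    using that irrefl L edge_block by (intro distinct_adj_concat_map[of _ _ x y]) auto
  \<comment> \<open>Only neighbours of \<open>x\<close> are written between the two copies of
    \<open>x\<close> in \<open>W x L\<close>; restricted to \<open>x\<close> and a non-neighbour
    \<open>y\<close>, these copies become consecutive.\<close>
  have non_edge_block: "\<not> distinct_adj (f x y (W x L))"
    if V: "x \<in> V" "y \<in> V" "x \<noteq> y" and E: "\<not> E x y" for x y
  proof -
    have ir: "\<not> P x x" "\<not> (P x y \<and> P y x)" "\<not> E y x"
      using irrefl trans[of x y x] V E sym by auto
    show ?thesis
      unfolding f_W using f_L[OF V] ir V
      unfolding W_def blocks_def A_def I_def O'_def B_def T_def
      by (cases "P x y"; cases "P y x"; auto)
  qed
  have non_edge: "\<not> distinct_adj (f x y (concat (map (\<lambda>v. W v L) L)))"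
    if V: "x \<in> V" "y \<in> V" "x \<noteq> y" and E: "\<not> E x y" for x y
  proof -
    obtain us vs where "L = us @ x # vs" using split_list V(1) L(1) by metis
    then have "f x y (concat (map (\<lambda>v. W v L) L)) =
        f x y (concat (map (\<lambda>v. W v L) us)) @ f x y (W x L) @ f x y (concat (map (\<lambda>v. W v L) vs))"
      by (simp add: f_def)
    then show ?thesis
      using non_edge_block[OF V E] by (auto simp: distinct_adj_append_iff)
  qed
  define w where "w = concat (map (\<lambda>v. W v L) L)"
  have "set w = V"
  proof -
    have "set (W v L) \<subseteq> V" for v unfolding W_def using L(1) by auto
    moreover have "v \<in> set (W v L)" if "v \<in> V" for v
      unfolding W_def blocks_def using L(1) that by simp
    ultimately show ?thesis unfolding w_def using L(1) by auto
  qed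
  moreover have "alternate x y w \<longleftrightarrow> {x, y} \<in> edges G" if V: "x \<in> V" "y \<in> V" "x \<noteq> y" for x y
  proof -
    have "alternate x y w \<longleftrightarrow> distinct_adj (f x y w)" for x y
      by (simp add: alternate_def f_def)
    then show ?thesis
      using edge[of x y] edge[of y x] non_edge[of x y] comp[of x y] V sym[of x y]
        alternate_commute[of x y w]
      unfolding w_def E_def by blast
  qed
  ultimately show ?thesis
    unfolding word_representable_def V_def by blast
qed

section \<open>The six forbidden graphs\<close>

lemma edge_graph_of_list: "{a, b} \<in> edges (graph_of_list k ps) \<longleftrightarrow> (a, b) \<in> set ps \<or> (b, a) \<in> set ps"
  unfolding graph_of_list_def by (auto simp: doubleton_eq_iff)

text \<open>The order is pulled back along the embedding. That the copy is induced matters for the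
  last clause, which has to turn edges of \<open>G\<close> into edges of \<open>H\<close>.\<close>

lemma convex_order_contains_induced:
  assumes "convex_order G P" "contains_induced G H"
  shows "\<exists>Q. convex_order H Q"
proof -
  obtain S f where S: "S \<subseteq> verts G" and f: "bij_betw f (verts H) S"
    and e: "\<And>x y. x \<in> verts H \<Longrightarrow> y \<in> verts H \<Longrightarrow>
      {x, y} \<in> edges H \<longleftrightarrow> {f x, f y} \<in> edges (induced_subgraph G S)"
    using assms(2) unfolding contains_induced_def graph_isomorphic_def induced_subgraph_def by auto
  have fS: "f x \<in> S" if "x \<in> verts H" for x using f that bij_betwE by fast
  have fV: "f x \<in> verts G" if "x \<in> verts H" for x using fS[OF that] S by blast
  have e': "{x, y} \<in> edges H \<longleftrightarrow> {f x, f y} \<in> edges G" if "x \<in> verts H" "y \<in> verts H" for x y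
    using e[OF that] fS that unfolding induced_subgraph_def by auto
  have inj: "f x \<noteq> f y" if "x \<in> verts H" "y \<in> verts H" "x \<noteq> y" for x y
    using f that unfolding bij_betw_def inj_on_def by blast
  have "convex_order H (\<lambda>x y. P (f x) (f y))"
  proof (rule convex_orderI)
    show "\<not> P (f x) (f x)" if "x \<in> verts H" for x
      using convex_orderD(1)[OF assms(1) fV[OF that]] .
    show "P (f x) (f z)" if "x \<in> verts H" "y \<in> verts H" "z \<in> verts H" "P (f x) (f y)" "P (f y) (f z)" for x y z
      using convex_orderD(2)[OF assms(1)] fV that by blast
    show "P (f x) (f y) \<or> P (f y) (f x)"
      if "x \<in> verts H" "y \<in> verts H" "x \<noteq> y" "{x, y} \<in> edges H" for x y
      using convex_orderD(3)[OF assms(1)] fV that inj e' by blast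
    show "{x, y} \<in> edges H \<and> {y, z} \<in> edges H"
      if "x \<in> verts H" "y \<in> verts H" "z \<in> verts H" "{x, z} \<in> edges H" "P (f x) (f y)" "P (f y) (f z)" for x y z
      using convex_orderD(4)[OF assms(1)] fV that e' by blast
  qed
  then show ?thesis by blast
qed

text \<open>
  For an orientation of the cycle \<open>a b c d\<close> this means that exactly two arcs go each way round.
\<close>
definition balanced :: "('a \<Rightarrow> 'a \<Rightarrow> bool) \<Rightarrow> 'a \<Rightarrow> 'a \<Rightarrow> 'a \<Rightarrow> 'a \<Rightarrow> bool" where
  "balanced P a b c d \<longleftrightarrow>
     \<not> (P a b \<and> P b c \<and> P c d) \<and> \<not> (P b c \<and> P c d \<and> P d a) \<and>
     \<not> (P c d \<and> P d a \<and> P a b) \<and> \<not> (P d a \<and> P a b \<and> P b c) \<and>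
     \<not> (P d c \<and> P c b \<and> P b a) \<and> \<not> (P c b \<and> P b a \<and> P a d) \<and>
     \<not> (P b a \<and> P a d \<and> P d c) \<and> \<not> (P a d \<and> P d c \<and> P c b)"

text \<open>A directed path would place \<open>b\<close> and \<open>c\<close> between the ends of
  the edge \<open>a d\<close>, and convexity would then force both diagonals.\<close>

lemma four_cycle_no_directed_path:
  assumes P: "convex_order G P"
    and V: "a \<in> verts G" "b \<in> verts G" "c \<in> verts G" "d \<in> verts G" "a \<noteq> d"
    and ad: "{a, d} \<in> edges G"
    and diag: "{a, c} \<notin> edges G \<or> {b, d} \<notin> edges G"
  shows "\<not> (P a b \<and> P b c \<and> P c d)"
proof
  assume path: "P a b \<and> P b c \<and> P c d"
  then have "P a c" "P b d"
    using convex_orderD(2)[OF P] V by blast+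
  then show False
    using convex_orderD(4)[OF P, of a c d] convex_orderD(4)[OF P, of a b d] path V ad diag by blast
qed

lemma four_cycle_balanced:
  assumes P: "convex_order G P"
    and V: "a \<in> verts G" "b \<in> verts G" "c \<in> verts G" "d \<in> verts G" "distinct [a, b, c, d]"
    and E: "{a, b} \<in> edges G" "{b, c} \<in> edges G" "{c, d} \<in> edges G" "{a, d} \<in> edges G"
    and diag: "{a, c} \<notin> edges G \<or> {b, d} \<notin> edges G"
  shows "balanced P a b c d"
proof -
  have "{b, a} \<in> edges G" "{c, b} \<in> edges G" "{d, c} \<in> edges G" "{d, a} \<in> edges G"
    using E by (simp_all add: insert_commute)
  moreover have "{c, a} \<notin> edges G \<or> {b, d} \<notin> edges G" "{a, c} \<notin> edges G \<or> {d, b} \<notin> edges G"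
    "{c, a} \<notin> edges G \<or> {d, b} \<notin> edges G"
    using diag by (simp_all add: insert_commute)
  ultimately show ?thesis
    unfolding balanced_def using V E diag
    by (intro conjI four_cycle_no_directed_path[OF P]) auto
qed

text \<open>A computable form of the hypotheses of \<open>four_cycle_balanced\<close>, checked by
  simplification on an edge list.\<close>

definition non_clique_cycle :: "(nat \<times> nat) list \<Rightarrow> nat \<times> nat \<times> nat \<times> nat \<Rightarrow> bool" where
  "non_clique_cycle ps = (\<lambda>(a, b, c, d).
     let adj = (\<lambda>x y. (x, y) \<in> set ps \<or> (y, x) \<in> set ps)
     in distinct [a, b, c, d] \<and> adj a b \<and> adj b c \<and> adj c d \<and> adj a d \<and> \<not> (adj a c \<and> adj b d))"

text \<open>Reduces nonexistence to propositional logic: each edge has one truth value, its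
  direction, and each cycle in \<open>qs\<close> contributes the eight clauses of
  \<open>balanced\<close>.\<close>

lemma no_convex_order_graph_of_list:
  assumes ps: "list_all (\<lambda>(a, b). a \<in> {1..k} \<and> b \<in> {1..k} \<and> a \<noteq> b) ps"
    and qs: "list_all (non_clique_cycle ps) qs"
    and unsat: "list_all (\<lambda>(a, b). P b a \<longleftrightarrow> \<not> P a b) ps \<Longrightarrow>
      list_all (\<lambda>(a, b, c, d). balanced P a b c d) qs \<Longrightarrow> False"
  shows "\<not> convex_order (graph_of_list k ps) P"
proof
  assume P: "convex_order (graph_of_list k ps) P"
  have V: "verts (graph_of_list k ps) = {1..k}" by (simp add: graph_of_list_def)
  have ps': "a \<in> {1..k}" "b \<in> {1..k}" "a \<noteq> b" if "(a, b) \<in> set ps" for a b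
    using ps that by (auto simp: list_all_iff)
  have "P b a \<longleftrightarrow> \<not> P a b" if "(a, b) \<in> set ps" for a b
    using convex_orderD(1-3)[OF P, unfolded V edge_graph_of_list] ps'[OF that] that by metis
  moreover have "balanced P a b c d" if "(a, b, c, d) \<in> set qs" for a b c d
  proof (rule four_cycle_balanced[OF P, unfolded V edge_graph_of_list])
    have "non_clique_cycle ps (a, b, c, d)" using qs that by (auto simp: list_all_iff)
    then have *: "distinct [a, b, c, d]" "(a, b) \<in> set ps \<or> (b, a) \<in> set ps"
      "(b, c) \<in> set ps \<or> (c, b) \<in> set ps" "(c, d) \<in> set ps \<or> (d, c) \<in> set ps"
      "(a, d) \<in> set ps \<or> (d, a) \<in> set ps"
      "\<not> ((a, c) \<in> set ps \<or> (c, a) \<in> set ps) \<or> \<not> ((b, d) \<in> set ps \<or> (d, b) \<in> set ps)"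
      by (auto simp: non_clique_cycle_def Let_def)
    show "distinct [a, b, c, d]" "(a, b) \<in> set ps \<or> (b, a) \<in> set ps"
      "(b, c) \<in> set ps \<or> (c, b) \<in> set ps" "(c, d) \<in> set ps \<or> (d, c) \<in> set ps"
      "(a, d) \<in> set ps \<or> (d, a) \<in> set ps"
      "\<not> ((a, c) \<in> set ps \<or> (c, a) \<in> set ps) \<or> \<not> ((b, d) \<in> set ps \<or> (d, b) \<in> set ps)"
      using * by blast+
    show "a \<in> {1..k}" "b \<in> {1..k}" "c \<in> {1..k}" "d \<in> {1..k}"
      using * ps' by blast+
  qed
  ultimately show False
    by (intro unsat) (auto simp: list_all_iff)
qed

text \<open>Here and for the other five graphs, \<open>qs\<close> lists 4-cycles whose balance
  conditions are jointly unsatisfiable. The edge list and the cycles are checked first;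
  \<open>sat\<close> then refutes the clauses.\<close>

lemma no_convex_order_H1: "\<not> convex_order H1 P"
  unfolding H1_def
  by (rule no_convex_order_graph_of_list[where qs =
        "[(1,2,5,3), (1,2,5,4), (1,3,6,5), (1,4,7,5),
          (3,5,7,6), (4,5,6,7)]"])
     (simp, simp add: non_clique_cycle_def, unfold list.pred_inject prod.case balanced_def, sat)

lemma no_convex_order_H2: "\<not> convex_order H2 P"
  unfolding H2_def
  by (rule no_convex_order_graph_of_list[where qs =
        "[(1,2,5,4), (1,2,6,5), (1,4,7,5), (2,5,7,6),
          (3,4,5,6), (3,4,7,6)]"])
     (simp, simp add: non_clique_cycle_def, unfold list.pred_inject prod.case balanced_def, sat)

lemma no_convex_order_H3: "\<not> convex_order H3 P"
  unfolding H3_def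
  by (rule no_convex_order_graph_of_list[where qs =
        "[(1,2,3,4), (1,2,7,4), (2,3,7,5), (2,4,3,6),
          (2,4,7,5), (2,6,8,7), (3,6,8,7)]"])
     (simp, simp add: non_clique_cycle_def, unfold list.pred_inject prod.case balanced_def, sat)

lemma no_convex_order_H4: "\<not> convex_order H4 P"
  unfolding H4_def
  by (rule no_convex_order_graph_of_list[where qs =
        "[(1,2,6,3), (1,2,7,3), (2,4,7,5), (2,4,7,6),
          (2,5,8,7), (3,6,5,7), (5,6,7,8)]"])
     (simp, simp add: non_clique_cycle_def, unfold list.pred_inject prod.case balanced_def, sat)

lemma no_convex_order_H5: "\<not> convex_order H5 P"
  unfolding H5_def
  by (rule no_convex_order_graph_of_list[where qs =
        "[(1,3,6,4), (1,3,8,4), (2,4,3,5), (2,4,8,5),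
          (3,4,7,8), (3,5,4,6), (4,5,8,7)]"])
     (simp, simp add: non_clique_cycle_def, unfold list.pred_inject prod.case balanced_def, sat)

lemma no_convex_order_H6: "\<not> convex_order H6 P"
  unfolding H6_def
  by (rule no_convex_order_graph_of_list[where qs =
        "[(1,4,3,5), (1,4,7,5), (2,3,4,5), (2,3,7,5),
          (3,5,4,6), (3,6,8,7), (4,6,8,7)]"])
     (simp, simp add: non_clique_cycle_def, unfold list.pred_inject prod.case balanced_def, sat)

section \<open>Pairs of consecutive layers\<close>

text \<open>The bit \<open>b j\<close> tells whether the diagonal of cell \<open>j\<close> runs from \<open>(i, j)\<close> to \<open>(i + 1, j + 1)\<close>.\<close>
definition cross :: "(nat \<Rightarrow> bool) \<Rightarrow> nat \<Rightarrow> nat \<Rightarrow> bool" where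
  "cross b a c \<longleftrightarrow> a = c \<or> b a \<and> c = (a + 1) mod 3 \<or> \<not> b c \<and> a = (c + 1) mod 3"

text \<open>With three columns every row is a triangle, so distinct vertices of one row are always
  adjacent.\<close>

definition strip_adj :: "(nat \<Rightarrow> nat \<Rightarrow> bool) \<Rightarrow> nat \<times> nat \<Rightarrow> nat \<times> nat \<Rightarrow> bool" where
  "strip_adj b x y \<longleftrightarrow>
     fst x = fst y \<and> snd x \<noteq> snd y \<or>
     fst y = Suc (fst x) \<and> cross (b (fst x)) (snd x) (snd y) \<or>
     fst x = Suc (fst y) \<and> cross (b (fst y)) (snd y) (snd x)"

lemma less_3_iff: "(a::nat) < 3 \<longleftrightarrow> a = 0 \<or> a = 1 \<or> a = 2"
  by auto

text \<open>Replaces the edge set by an adjacency predicate depending on one bit per cell; all later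
  arguments use this form.\<close>

lemma cylinder_triangulation_strip:
  assumes "cylinder_triangulation 3 n T"
  obtains b where "verts T = {0..n} \<times> {0..<3}"
    and "\<And>x y. x \<in> verts T \<Longrightarrow> y \<in> verts T \<Longrightarrow> {x, y} \<in> edges T \<longleftrightarrow> strip_adj b x y"
proof -
  obtain d where d: "\<And>i j. i < n \<Longrightarrow> j < 3 \<Longrightarrow> d i j \<in> cell_diagonals 3 i j"
    and T: "T = (verts (cylinder_graph 3 n),
               edges (cylinder_graph 3 n) \<union> {d i j | i j. i < n \<and> j < 3})"
    using assms unfolding cylinder_triangulation_def by blast
  define b where "b i j \<longleftrightarrow> d i j = {(i, j), (i + 1, (j + 1) mod 3)}" for i j
  have d': "d i j = (if b i j then {(i, j), (i + 1, (j + 1) mod 3)} else {(i + 1, j), (i, (j + 1) mod 3)})"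
    if "i < n" "j < 3" for i j
  proof -
    have "d i j = {(i, j), (i + 1, (j + 1) mod 3)} \<or> d i j = {(i + 1, j), (i, (j + 1) mod 3)}"
      using d[OF that] unfolding cell_diagonals_def by blast
    then show ?thesis by (cases "b i j") (simp_all only: b_def if_True if_False simp_thms)
  qed
  have verts: "verts T = {0..n} \<times> {0..<3}"
    by (simp add: T cylinder_graph_def)
  have "{(i, a), (k, c)} \<in> edges T \<longleftrightarrow> strip_adj b (i, a) (k, c)"
    if "i \<le> n" "k \<le> n" "a < 3" "c < 3" for i a k c
  proof -
    have lt: "k = i + 1 \<longrightarrow> i < n" "i = k + 1 \<longrightarrow> k < n" using that by auto
    \<comment> \<open>Any two distinct residues modulo 3 are cyclically consecutive in one direction
      or the other.\<close>
    have mod: "c = (a + 1) mod 3 \<or> a = (c + 1) mod 3 \<longleftrightarrow> a \<noteq> c"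
      using that(3,4) unfolding less_3_iff by (elim disjE; simp)
    have horizontal: "{(i, a), (k, c)} \<in> {{(i, j), (i, (j + 1) mod 3)} | i j. i \<le> n \<and> j < 3} \<longleftrightarrow>
        i = k \<and> (c = (a + 1) mod 3 \<or> a = (c + 1) mod 3)"
      unfolding mem_Collect_eq doubleton_eq_iff prod.inject using that by blast
    have vertical: "{(i, a), (k, c)} \<in> {{(i, j), (i + 1, j)} | i j. i < n \<and> j < 3} \<longleftrightarrow>
        a = c \<and> (k = i + 1 \<or> i = k + 1)"
      unfolding mem_Collect_eq doubleton_eq_iff prod.inject using that lt by blast
    have "{(i, a), (k, c)} \<in> {d i j | i j. i < n \<and> j < 3} \<longleftrightarrow>
        (\<exists>i' j'. i' < n \<and> j' < 3 \<and> (b i' j' \<and> {(i, a), (k, c)} = {(i', j'), (i' + 1, (j' + 1) mod 3)} \<or>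
           \<not> b i' j' \<and> {(i, a), (k, c)} = {(i' + 1, j'), (i', (j' + 1) mod 3)}))"
      using d' unfolding mem_Collect_eq by metis
    also have "\<dots> \<longleftrightarrow>
        k = i + 1 \<and> (b i a \<and> c = (a + 1) mod 3 \<or> \<not> b i c \<and> a = (c + 1) mod 3) \<or>
        i = k + 1 \<and> (b k c \<and> a = (c + 1) mod 3 \<or> \<not> b k a \<and> c = (a + 1) mod 3)"
      (is "?L \<longleftrightarrow> ?R")
    proof
      show ?R if ?L
        using that unfolding doubleton_eq_iff prod.inject by (elim exE conjE disjE) blast+
      show ?L if ?R
        using that
      proof (elim disjE conjE)
        assume "k = i + 1" "b i a" "c = (a + 1) mod 3"
        then show ?L using lt \<open>a < 3\<close> by blast
      next
        assume "k = i + 1" "\<not> b i c" "a = (c + 1) mod 3"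
        then show ?L using lt \<open>c < 3\<close> by (blast intro: insert_commute)
      next
        assume "i = k + 1" "b k c" "a = (c + 1) mod 3"
        then show ?L using lt \<open>c < 3\<close> by (blast intro: insert_commute)
      next
        assume "i = k + 1" "\<not> b k a" "c = (a + 1) mod 3"
        then show ?L using lt \<open>a < 3\<close> by blast
      qed
    qed
    finally have diagonal: "{(i, a), (k, c)} \<in> {d i j | i j. i < n \<and> j < 3} \<longleftrightarrow> ?R" .
    show ?thesis
      unfolding T strip_adj_def cross_def cylinder_graph_def Suc_eq_plus1 fst_conv snd_conv Un_iff
        horizontal vertical diagonal mod
      using eq_commute[of c a] by sat
  qed
  then show ?thesis
    using that[of b] verts by auto
qed

text \<open>A layer is given by three separate booleans so that all pairs of layers can be run
  through by case distinction.\<close>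

definition bits :: "bool \<Rightarrow> bool \<Rightarrow> bool \<Rightarrow> nat \<Rightarrow> bool" where
  "bits b0 b1 b2 j = (if j = 0 then b0 else if j = 1 then b1 else b2)"

section \<open>Symmetries of a strip of two layers\<close>

lemma cross_rotate:
  assumes "a < 3" "c < 3"
  shows "cross (bits b2 b0 b1) (Suc a mod 3) (Suc c mod 3) \<longleftrightarrow> cross (bits b0 b1 b2) a c"
  using assms unfolding less_3_iff by (elim disjE; simp add: cross_def bits_def)

text \<open>Negating columns modulo 3 moves cell \<open>j\<close> to cell \<open>2 - j\<close> and
  exchanges the two kinds of diagonal, so the bits are reversed and negated.\<close>

lemma cross_reflect:
  assumes "a < 3" "c < 3"
  shows "cross (bits (\<not> b2) (\<not> b1) (\<not> b0)) ((3 - a) mod 3) ((3 - c) mod 3) \<longleftrightarrow> cross (bits b0 b1 b2) a c"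
  using assms unfolding less_3_iff by (elim disjE; simp add: cross_def bits_def)

text \<open>Exchanging the two rows keeps each cell in its column but exchanges the two kinds of
  diagonal.\<close>

lemma cross_flip:
  assumes "a < 3" "c < 3"
  shows "cross (bits (\<not> b0) (\<not> b1) (\<not> b2)) c a \<longleftrightarrow> cross (bits b0 b1 b2) a c"
  using assms unfolding less_3_iff by (elim disjE; simp add: cross_def bits_def)

text \<open>An induced copy within rows 0, 1 and 2; only the layers \<open>b 0\<close> and
  \<open>b 1\<close> are consulted.\<close>

definition embeds :: "nat graph \<Rightarrow> (nat \<Rightarrow> nat \<Rightarrow> bool) \<Rightarrow> (nat \<Rightarrow> nat \<times> nat) \<Rightarrow> bool" where
  "embeds H b f \<longleftrightarrow> inj_on f (verts H) \<and> f ` verts H \<subseteq> {0..2} \<times> {0..<3} \<and>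
     (\<forall>x \<in> verts H. \<forall>y \<in> verts H. {x, y} \<in> edges H \<longleftrightarrow> strip_adj b (f x) (f y))"

definition obstructed :: "bool \<Rightarrow> bool \<Rightarrow> bool \<Rightarrow> bool \<Rightarrow> bool \<Rightarrow> bool \<Rightarrow> bool" where
  "obstructed b0 b1 b2 c0 c1 c2 \<longleftrightarrow>
     (\<exists>H \<in> {H1, H2, H3, H4, H5, H6}. \<exists>f. embeds H (\<lambda>i. if i = 0 then bits b0 b1 b2 else bits c0 c1 c2) f)"

text \<open>The common argument for all three symmetries: the embedding is composed with an
  adjacency-preserving injection of the three rows.\<close>

lemma obstructed_transfer:
  assumes "obstructed b0 b1 b2 c0 c1 c2"
    and g: "inj_on g ({0..2} \<times> {0..<3})" "g ` ({0..2} \<times> {0..<3}) \<subseteq> {0..2} \<times> {0..<3}"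
    and adj: "\<And>x y. x \<in> {0..2} \<times> {0..<3} \<Longrightarrow> y \<in> {0..2} \<times> {0..<3} \<Longrightarrow>
      strip_adj (\<lambda>i. if i = 0 then bits b0' b1' b2' else bits c0' c1' c2') (g x) (g y) \<longleftrightarrow>
      strip_adj (\<lambda>i. if i = 0 then bits b0 b1 b2 else bits c0 c1 c2) x y"
  shows "obstructed b0' b1' b2' c0' c1' c2'"
proof -
  obtain H f where H: "H \<in> {H1, H2, H3, H4, H5, H6}"
    and f: "embeds H (\<lambda>i. if i = 0 then bits b0 b1 b2 else bits c0 c1 c2) f"
    using assms(1) unfolding obstructed_def by blast
  have mem: "f x \<in> {0..2} \<times> {0..<3}" if "x \<in> verts H" for x
    using f that unfolding embeds_def by blast
  have "inj_on (g \<circ> f) (verts H)"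
    using f g(1) unfolding embeds_def by (blast intro: comp_inj_on inj_on_subset)
  moreover have "(g \<circ> f) ` verts H \<subseteq> {0..2} \<times> {0..<3}"
    using mem g(2) by force
  moreover have "{x, y} \<in> edges H \<longleftrightarrow>
      strip_adj (\<lambda>i. if i = 0 then bits b0' b1' b2' else bits c0' c1' c2') ((g \<circ> f) x) ((g \<circ> f) y)"
    if "x \<in> verts H" "y \<in> verts H" for x y
    using f that adj[OF mem mem] unfolding embeds_def comp_def by blast
  ultimately have "embeds H (\<lambda>i. if i = 0 then bits b0' b1' b2' else bits c0' c1' c2') (g \<circ> f)"
    unfolding embeds_def by blast
  then show ?thesis using H unfolding obstructed_def by blast
qed

lemma obstructed_rotate:
  assumes "obstructed b0 b1 b2 c0 c1 c2"
  shows "obstructed b2 b0 b1 c2 c0 c1"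
proof (rule obstructed_transfer[OF assms, where g = "\<lambda>(i, a). (i, Suc a mod 3)"])
  have inj: "Suc a mod 3 = Suc c mod 3 \<longleftrightarrow> a = c" if "a < 3" "c < 3" for a c
    using that unfolding less_3_iff by (elim disjE; simp)
  show "inj_on (\<lambda>(i::nat, a). (i, Suc a mod 3)) ({0..2} \<times> {0..<3})"
    by (auto simp: inj_on_def inj)
  fix x y :: "nat \<times> nat" assume "x \<in> {0..2} \<times> {0..<3}" "y \<in> {0..2} \<times> {0..<3}"
  then show "strip_adj (\<lambda>i. if i = 0 then bits b2 b0 b1 else bits c2 c0 c1)
       (case x of (i, a) \<Rightarrow> (i, Suc a mod 3)) (case y of (i, a) \<Rightarrow> (i, Suc a mod 3)) \<longleftrightarrow>
     strip_adj (\<lambda>i. if i = 0 then bits b0 b1 b2 else bits c0 c1 c2) x y"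
    by (cases x; cases y) (simp add: strip_adj_def cross_rotate inj)
qed auto

lemma obstructed_reflect:
  assumes "obstructed b0 b1 b2 c0 c1 c2"
  shows "obstructed (\<not> b2) (\<not> b1) (\<not> b0) (\<not> c2) (\<not> c1) (\<not> c0)"
proof (rule obstructed_transfer[OF assms, where g = "\<lambda>(i, a). (i, (3 - a) mod 3)"])
  have inj: "(3 - a) mod 3 = (3 - c) mod 3 \<longleftrightarrow> a = c" if "a < 3" "c < 3" for a c :: nat
    using that unfolding less_3_iff by (elim disjE; simp)
  show "inj_on (\<lambda>(i::nat, a::nat). (i, (3 - a) mod 3)) ({0..2} \<times> {0..<3})"
    by (auto simp: inj_on_def inj)
  fix x y :: "nat \<times> nat" assume "x \<in> {0..2} \<times> {0..<3}" "y \<in> {0..2} \<times> {0..<3}"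
  then show "strip_adj (\<lambda>i. if i = 0 then bits (\<not> b2) (\<not> b1) (\<not> b0) else bits (\<not> c2) (\<not> c1) (\<not> c0))
       (case x of (i, a) \<Rightarrow> (i, (3 - a) mod 3)) (case y of (i, a) \<Rightarrow> (i, (3 - a) mod 3)) \<longleftrightarrow>
     strip_adj (\<lambda>i. if i = 0 then bits b0 b1 b2 else bits c0 c1 c2) x y"
    by (cases x; cases y) (simp add: strip_adj_def cross_reflect inj)
qed auto

text \<open>Sending row \<open>i\<close> to row \<open>2 - i\<close> also exchanges the two layers,
  so the negated bits of the second come first.\<close>

lemma obstructed_flip:
  assumes "obstructed b0 b1 b2 c0 c1 c2"
  shows "obstructed (\<not> c0) (\<not> c1) (\<not> c2) (\<not> b0) (\<not> b1) (\<not> b2)"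
proof (rule obstructed_transfer[OF assms, where g = "\<lambda>(i, a). (2 - i, a)"])
  fix x y :: "nat \<times> nat" assume x: "x \<in> {0..2} \<times> {0..<3}" and y: "y \<in> {0..2} \<times> {0..<3}"
  then have "fst x \<in> {0, 1, 2}" "fst y \<in> {0, 1, 2}" "snd x < 3" "snd y < 3" by auto
  then show "strip_adj (\<lambda>i. if i = 0 then bits (\<not> c0) (\<not> c1) (\<not> c2) else bits (\<not> b0) (\<not> b1) (\<not> b2))
       (case x of (i, a) \<Rightarrow> (2 - i, a)) (case y of (i, a) \<Rightarrow> (2 - i, a)) \<longleftrightarrow>
     strip_adj (\<lambda>i. if i = 0 then bits b0 b1 b2 else bits c0 c1 c2) x y"
    by (cases x; cases y) (auto simp: strip_adj_def cross_flip)
qed (auto simp: inj_on_def)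

section \<open>Explicit induced copies\<close>

text \<open>A computable form of \<open>embeds\<close>: \<open>vs\<close> lists the positions of
  vertices 1, 2, and so on. List indices start at 0, whence the successors.\<close>

definition list_embeds :: "(nat \<times> nat) list \<Rightarrow> (nat \<Rightarrow> nat \<Rightarrow> bool) \<Rightarrow> (nat \<times> nat) list \<Rightarrow> bool" where
  "list_embeds ps b vs \<longleftrightarrow>
     distinct vs \<and> list_all (\<lambda>x. fst x \<le> 2 \<and> snd x < 3) vs \<and>
     list_all (\<lambda>p. list_all (\<lambda>q.
       ((Suc p, Suc q) \<in> set ps \<or> (Suc q, Suc p) \<in> set ps) = strip_adj b (vs ! p) (vs ! q))
       [0..<length vs]) [0..<length vs]"

lemma embeds_graph_of_list:
  assumes "list_embeds ps b vs"
  shows "embeds (graph_of_list (length vs) ps) b (\<lambda>p. vs ! (p - 1))"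
proof -
  have V: "verts (graph_of_list (length vs) ps) = {1..length vs}" by (simp add: graph_of_list_def)
  have Suc: "\<exists>q < length vs. p = Suc q" if "p \<in> {1..length vs}" for p
    using that by (intro exI[of _ "p - 1"]) auto
  have "inj_on (\<lambda>p. vs ! (p - 1)) {1..length vs}"
    using assms unfolding list_embeds_def inj_on_def by (auto simp: nth_eq_iff_index_eq dest!: Suc)
  moreover have "vs ! (p - 1) \<in> {0..2} \<times> {0..<3}" if "p \<in> {1..length vs}" for p
  proof -
    have "vs ! (p - 1) \<in> set vs" using that by (intro nth_mem) auto
    then show ?thesis using assms unfolding list_embeds_def list_all_iff by (auto simp: mem_Times_iff)
  qed
  moreover have "(p, q) \<in> set ps \<or> (q, p) \<in> set ps \<longleftrightarrow> strip_adj b (vs ! (p - 1)) (vs ! (q - 1))"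
    if pq: "p \<in> {1..length vs}" "q \<in> {1..length vs}" for p q
  proof -
    obtain p' q' where "p' < length vs" "p = Suc p'" "q' < length vs" "q = Suc q'"
      using Suc[OF pq(1)] Suc[OF pq(2)] by blast
    then show ?thesis using assms unfolding list_embeds_def list_all_iff by simp
  qed
  ultimately show ?thesis
    unfolding embeds_def V edge_graph_of_list by blast
qed

lemma obstructed_graph_of_list:
  assumes "H \<in> {H1, H2, H3, H4, H5, H6}" "H = graph_of_list k ps" "k = length vs"
    and "list_embeds ps (\<lambda>i. if i = 0 then bits b0 b1 b2 else bits c0 c1 c2) vs"
  shows "obstructed b0 b1 b2 c0 c1 c2"
proof -
  have "embeds H (\<lambda>i. if i = 0 then bits b0 b1 b2 else bits c0 c1 c2) (\<lambda>p. vs ! (p - 1))"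
    unfolding assms(2,3) using assms(4) by (rule embeds_graph_of_list)
  then show ?thesis
    unfolding obstructed_def using assms(1) by (intro bexI[of _ H] exI)
qed

text \<open>
  Representatives of the five orbits of the 48 incompatible pairs under rotating and reflecting the
  columns and turning the strip upside down.
\<close>
lemma obstructed_representatives:
  "obstructed True True True True True False"
  "obstructed True True True True False False"
  "obstructed True True False True False True"
  "obstructed True True False True False False"
  "obstructed True True False False True True"
proof -
  \<comment> \<open>Each \<open>vs\<close> exhibits a copy by giving the (row, column) positions of
    its vertices in order; evaluation compares all pairs.\<close>
  show "obstructed True True True True True False"
    by (rule obstructed_graph_of_list[OF _ H1_def, where
          vs = "[(2,2), (2,0), (1,1), (1,2), (1,0), (0,0), (0,2)]"]) (simp, simp, code_simp)
  show "obstructed True True True True False False"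
    by (rule obstructed_graph_of_list[OF _ H1_def, where
          vs = "[(2,1), (2,0), (1,1), (1,2), (1,0), (0,0), (0,2)]"]) (simp, simp, code_simp)
  show "obstructed True True False True False True"
    by (rule obstructed_graph_of_list[OF _ H5_def, where
          vs = "[(0,0), (0,1), (1,0), (1,2), (1,1), (2,0), (2,2), (2,1)]"]) (simp, simp, code_simp)
  show "obstructed True True False True False False"
    by (rule obstructed_graph_of_list[OF _ H4_def, where
          vs = "[(2,0), (1,0), (2,1), (2,2), (0,0), (1,1), (1,2), (0,2)]"]) (simp, simp, code_simp)
  show "obstructed True True False False True True"
    by (rule obstructed_graph_of_list[OF _ H4_def, where
          vs = "[(0,2), (1,2), (0,0), (0,1), (2,0), (1,0), (1,1), (2,1)]"]) (simp, simp, code_simp)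
qed

text \<open>Of the 64 pairs of layers 16 are compatible: 4 pairs of antiprisms and 6 * 2 pairs of
  half graphs. The orbits of the five representatives cover the other 48.\<close>

lemma obstructed_if_incompatible:
  assumes "\<not> ((b0 = b1 \<and> b1 = b2 \<and> c0 = c1 \<and> c1 = c2) \<or>
    \<not> (b0 = b1 \<and> b1 = b2) \<and> (c0 = b0 \<and> c1 = b1 \<and> c2 = b2 \<or> c0 = (\<not> b0) \<and> c1 = (\<not> b1) \<and> c2 = (\<not> b2)))"
  shows "obstructed b0 b1 b2 c0 c1 c2"
proof -
  note reps = obstructed_representatives
  \<comment> \<open>The symmetry group has twelve elements: a power of the rotation, then possibly
    the reflection, then possibly the flip. These lists therefore contain whole orbits.\<close>
  note rotated = reps reps[THEN obstructed_rotate] reps[THEN obstructed_rotate, THEN obstructed_rotate]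
  note reflected = rotated rotated[THEN obstructed_reflect]
  note flipped = reflected reflected[THEN obstructed_flip]
  show ?thesis
    using assms
    by (cases b0; cases b1; cases b2; cases c0; cases c1; cases c2)
      (simp_all add: flipped[unfolded not_True_eq_False not_False_eq_True])
qed

section \<open>Convex orders on triangulations\<close>

text \<open>The copy is shifted to rows \<open>i\<close>, \<open>i + 1\<close> and
  \<open>i + 2\<close>. Adjacency there is that of the two-layer strip, so the shifted copy is still
  induced.\<close>

lemma obstructed_imp_contains_induced:
  assumes V: "verts T = {0..n} \<times> {0..<3}"
    and E: "\<And>x y. x \<in> verts T \<Longrightarrow> y \<in> verts T \<Longrightarrow> {x, y} \<in> edges T \<longleftrightarrow> strip_adj b x y"
    and "Suc i < n"
    and "obstructed (b i 0) (b i 1) (b i 2) (b (Suc i) 0) (b (Suc i) 1) (b (Suc i) 2)"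
  shows "\<exists>H \<in> {H1, H2, H3, H4, H5, H6}. contains_induced T H"
proof -
  define B where "B = (\<lambda>r::nat. if r = 0 then bits (b i 0) (b i 1) (b i 2) else bits (b (Suc i) 0) (b (Suc i) 1) (b (Suc i) 2))"
  obtain H f where H: "H \<in> {H1, H2, H3, H4, H5, H6}" and f: "embeds H B f"
    using assms(4) unfolding obstructed_def B_def by blast
  define g where "g x = (i + fst (f x), snd (f x))" for x
  have f_mem: "fst (f x) \<le> 2" "snd (f x) < 3" if "x \<in> verts H" for x
  proof -
    have "f x \<in> {0..2} \<times> {0..<3}" using f that unfolding embeds_def by blast
    then show "fst (f x) \<le> 2" "snd (f x) < 3" by auto
  qed
  have g_mem: "g x \<in> verts T" if "x \<in> verts H" for x
    using f_mem[OF that] assms(3) unfolding V g_def by auto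
  have inj: "inj_on g (verts H)"
    using f unfolding embeds_def g_def inj_on_def by (auto simp: prod_eq_iff)
  have bits: "bits (b k 0) (b k 1) (b k 2) a = b k a" if "a < 3" for k a
    using that unfolding bits_def less_3_iff by auto
  have cross: "cross (B r) a c \<longleftrightarrow> cross (b (i + r)) a c" if "r < 2" "a < 3" "c < 3" for r a c
  proof -
    have "B r a = b (i + r) a" if "a < 3" for a
      unfolding B_def using \<open>r < 2\<close> bits[OF that, of i] bits[OF that, of "Suc i"] by (auto simp: less_2_cases_iff)
    then show ?thesis using that(2,3) unfolding cross_def by blast
  qed
  have "strip_adj B x y \<longleftrightarrow> strip_adj b (i + fst x, snd x) (i + fst y, snd y)"
    if "fst x \<le> 2" "fst y \<le> 2" "snd x < 3" "snd y < 3" for x y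
  proof -
    consider "fst y = Suc (fst x)" | "fst x = Suc (fst y)" | "fst y \<noteq> Suc (fst x)" "fst x \<noteq> Suc (fst y)"
      by blast
    then show ?thesis
    proof cases
      case 1
      then show ?thesis using that cross[of "fst x" "snd x" "snd y"] by (simp add: strip_adj_def)
    next
      case 2
      then show ?thesis using that cross[of "fst y" "snd y" "snd x"] by (simp add: strip_adj_def)
    next
      case 3
      then show ?thesis by (simp add: strip_adj_def)
    qed
  qed
  then have adj: "{x, y} \<in> edges H \<longleftrightarrow> {g x, g y} \<in> edges T"
    if "x \<in> verts H" "y \<in> verts H" for x y
    using f f_mem that E[OF g_mem g_mem] unfolding embeds_def g_def by auto
  have "graph_isomorphic H (induced_subgraph T (g ` verts H))"
    unfolding graph_isomorphic_def induced_subgraph_def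
    using inj adj by (intro exI[of _ g]) (auto simp: inj_on_imp_bij_betw)
  then have "contains_induced T H"
    using g_mem unfolding contains_induced_def by blast
  then show ?thesis using H by blast
qed

section \<open>Constructions of convex orders\<close>

text \<open>Edges point to the larger colour, and directed 2-paths are added. If
  \<open>P x y\<close> and \<open>P y z\<close>, the colours are 0, 1, 2, so neither relation can
  come from a 2-path and both are edges; transitivity and convexity follow.\<close>

lemma convex_order_if_3_colourable:
  fixes c :: "'a \<Rightarrow> nat"
  assumes "\<And>x. x \<in> verts G \<Longrightarrow> c x < 3"
    and "\<And>x y. x \<in> verts G \<Longrightarrow> y \<in> verts G \<Longrightarrow> {x, y} \<in> edges G \<Longrightarrow> c x \<noteq> c y"
  shows "\<exists>P. convex_order G P"
proof -
  define P where "P x y \<longleftrightarrow> c x < c y \<and> ({x, y} \<in> edges G \<or>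
    (\<exists>m \<in> verts G. c x < c m \<and> c m < c y \<and> {x, m} \<in> edges G \<and> {m, y} \<in> edges G))" for x y
  have between: "{x, y} \<in> edges G \<and> {y, z} \<in> edges G"
    if "x \<in> verts G" "y \<in> verts G" "z \<in> verts G" "P x y" "P y z" for x y z
  proof -
    have "c x < c y" "c y < c z" "c z < 3" using that assms(1) unfolding P_def by auto
    then have "\<not> (c x < c m \<and> c m < c y)" "\<not> (c y < c m \<and> c m < c z)" for m by linarith+
    then show ?thesis using that unfolding P_def by blast
  qed
  have "convex_order G P"
  proof (rule convex_orderI)
    show "\<not> P x x" for x by (simp add: P_def)
    show "P x z" if "x \<in> verts G" "y \<in> verts G" "z \<in> verts G" "P x y" "P y z" for x y z
    proof -
      have "c x < c y" "c y < c z" using that unfolding P_def by auto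
      then show ?thesis using between[OF that] that(2) unfolding P_def by (metis less_trans)
    qed
    show "P x y \<or> P y x" if "x \<in> verts G" "y \<in> verts G" "x \<noteq> y" "{x, y} \<in> edges G" for x y
      using assms(2)[OF that(1,2,4)] that(4) unfolding P_def
      by (metis insert_commute linorder_neqE_nat)
    show "{x, y} \<in> edges G \<and> {y, z} \<in> edges G"
      if "x \<in> verts G" "y \<in> verts G" "z \<in> verts G" "{x, z} \<in> edges G" "P x y" "P y z" for x y z
      using between that by blast
  qed
  then show ?thesis by blast
qed

text \<open>Adding \<open>2 * m\<close> stands in for subtracting \<open>m\<close>, since
  \<open>3 * m\<close> vanishes modulo 3.\<close>

lemma mod_3_add_cancel:
  fixes a c m :: nat
  assumes "(a + m) mod 3 = (c + m) mod 3"
  shows "a mod 3 = c mod 3"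
proof -
  have "(a + m + 2 * m) mod 3 = (c + m + 2 * m) mod 3"
    using assms by (rule mod_add_cong) simp
  moreover have "x + m + 2 * m = x + 3 * m" for x by simp
  ultimately show ?thesis by (simp only: mod_mult_self2)
qed

text \<open>In an antiprism each vertex has exactly one non-neighbour in the next row, one column
  back if the bits are true and one column ahead otherwise. Giving that vertex the same colour
  shifts the colouring by 1 or 2; \<open>t i\<close> accumulates these shifts.\<close>

lemma convex_order_antiprisms:
  assumes V: "verts T = {0..n} \<times> {0..<3}"
    and E: "\<And>x y. x \<in> verts T \<Longrightarrow> y \<in> verts T \<Longrightarrow> {x, y} \<in> edges T \<longleftrightarrow> strip_adj b x y"
    and const: "\<And>i. i < n \<Longrightarrow> b i 0 = b i 1 \<and> b i 1 = b i 2"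
  shows "\<exists>P. convex_order T P"
proof -
  define t where "t i = (\<Sum>k<i. if b k 0 then 1 else 2 :: nat)" for i
  define col where "col x = (snd x + t (fst x)) mod 3" for x
  have cross: "(a + t i) mod 3 \<noteq> (c + t (Suc i)) mod 3"
    if "cross (b i) a c" "i < n" "a < 3" "c < 3" for i a c
  proof -
    have t: "t (Suc i) = t i + (if b i 0 then 1 else 2)" by (simp add: t_def)
    have "b i a = b i 0" "b i c = b i 0"
      using const[OF that(2)] that(3,4) unfolding less_3_iff by auto
    then have "if b i 0 then c = a \<or> c = (a + 1) mod 3 else c = a \<or> a = (c + 1) mod 3"
      using that(1) unfolding cross_def by auto
    then have ne: "a \<noteq> (c + (if b i 0 then 1 else 2)) mod 3"
      using \<open>a < 3\<close> \<open>c < 3\<close> unfolding less_3_iff by (cases "b i 0"; elim disjE; simp)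
    show ?thesis
    proof
      assume "(a + t i) mod 3 = (c + t (Suc i)) mod 3"
      then have "(a + t i) mod 3 = (c + (if b i 0 then 1 else 2) + t i) mod 3"
        unfolding t by (simp only: ac_simps)
      then have "a mod 3 = (c + (if b i 0 then 1 else 2)) mod 3"
        by (rule mod_3_add_cancel)
      then show False using ne \<open>a < 3\<close> by simp
    qed
  qed
  have row: "(a + t i) mod 3 \<noteq> (c + t i) mod 3" if "a \<noteq> c" "a < 3" "c < 3" for a c i
    using that mod_3_add_cancel[of a "t i" c] by auto
  show ?thesis
  proof (rule convex_order_if_3_colourable[of T col])
    show "col x < 3" for x by (simp add: col_def)
    fix x y assume xy: "x \<in> verts T" "y \<in> verts T" "{x, y} \<in> edges T"
    obtain i a k c where x: "x = (i, a)" and y: "y = (k, c)" by (cases x, cases y)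
    have "i \<le> n" "k \<le> n" "a < 3" "c < 3" using xy V x y by auto
    moreover have "strip_adj b (i, a) (k, c)" using E[OF xy(1,2)] xy(3) x y by simp
    ultimately show "col x \<noteq> col y"
      using row[of a c i] cross[of i a c] cross[of k c a] unfolding strip_adj_def col_def x y by auto
  qed
qed

text \<open>\<open>P\<close> is the product of the linear order of the columns by \<open>rk\<close>
  with a partial order \<open>Q\<close> of the rows. The edges are exactly the comparable pairs in
  equal or neighbouring rows, and \<open>Q\<close> is monotone along chains, so an intermediate
  vertex stays within those rows.\<close>

lemma convex_order_half_graphs:
  fixes rk :: "nat \<Rightarrow> nat" and s :: "nat \<Rightarrow> bool"
  assumes V: "verts T = {0..n} \<times> {0..<3}"
    and E: "\<And>x y. x \<in> verts T \<Longrightarrow> y \<in> verts T \<Longrightarrow> {x, y} \<in> edges T \<longleftrightarrow> strip_adj b x y"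
    and rk: "inj_on rk {0..<3}"
    and cross: "\<And>i a c. \<lbrakk>i < n; a < 3; c < 3\<rbrakk> \<Longrightarrow>
      cross (b i) a c \<longleftrightarrow> (if s i then rk a \<le> rk c else rk c \<le> rk a)"
  shows "\<exists>P. convex_order T P"
proof -
  \<comment> \<open>Reachability in the path of rows, where layer \<open>j\<close> is directed
    upwards if \<open>s j\<close> holds and downwards otherwise.\<close>
  define Q where "Q i k \<longleftrightarrow> i \<le> k \<and> (\<forall>j. i \<le> j \<and> j < k \<longrightarrow> s j) \<or> k \<le> i \<and> (\<forall>j. k \<le> j \<and> j < i \<longrightarrow> \<not> s j)" for i k
  define P where "P x y \<longleftrightarrow> x \<noteq> y \<and> rk (snd x) \<le> rk (snd y) \<and> Q (fst x) (fst y)" for x y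
  have Q_refl: "Q i i" for i unfolding Q_def by auto
  have Q_Suc: "Q i (Suc i) \<longleftrightarrow> s i" "Q (Suc i) i \<longleftrightarrow> \<not> s i" for i
    unfolding Q_def by (auto simp: le_less_Suc_eq)
  have Q_between: "i \<le> j \<and> j \<le> k \<or> k \<le> j \<and> j \<le> i" if "Q i j" "Q j k" for i j k
  proof (rule ccontr)
    assume "\<not> ?thesis"
    then consider "i < j" "k < j" | "j < i" "j < k" by linarith
    then show False
    proof cases
      case 1
      then have "\<forall>l. i \<le> l \<and> l < j \<longrightarrow> s l" "\<forall>l. k \<le> l \<and> l < j \<longrightarrow> \<not> s l"
        using that unfolding Q_def by auto
      \<comment> \<open>Layer \<open>j - 1\<close>, just below row \<open>j\<close>, would be
        directed both upwards and downwards; in the other case the same happens to layer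
        \<open>j\<close>.\<close>
      moreover have "i \<le> j - 1" "k \<le> j - 1" "j - 1 < j" using 1 by auto
      ultimately show False by blast
    next
      case 2
      then have "s j" "\<not> s j" using that unfolding Q_def by force+
      then show False by blast
    qed
  qed
  have Q_trans: "Q i k" if "Q i j" "Q j k" for i j k
    using Q_between[OF that] that unfolding Q_def by (smt (verit) le_trans not_le le_antisym)
  have Q_antisym: "i = j" if "Q i j" "Q j i" for i j
    using Q_between[OF that] by auto
  have rk_eq: "a = c" if "rk a = rk c" "a < 3" "c < 3" for a c
    using rk that unfolding inj_on_def by auto
  have edge: "{x, y} \<in> edges T \<longleftrightarrow> (P x y \<or> P y x) \<and> fst x \<le> Suc (fst y) \<and> fst y \<le> Suc (fst x)"
    if xy: "x \<in> verts T" "y \<in> verts T" for x y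
  proof -
    obtain i a k c where x: "x = (i, a)" and y: "y = (k, c)" by (cases x, cases y)
    have b: "i \<le> n" "k \<le> n" "a < 3" "c < 3" using xy V x y by auto
    consider "i = k" | "k = Suc i" | "i = Suc k" | "Suc i < k \<or> Suc k < i" by linarith
    then show ?thesis
    proof cases
      case 1
      then show ?thesis
        unfolding E[OF xy] using b rk_eq unfolding x y P_def strip_adj_def by (auto simp: Q_refl)
    next
      case 2
      then show ?thesis
        unfolding E[OF xy] using b cross[of i a c] unfolding x y P_def strip_adj_def by (auto simp: Q_Suc)
    next
      case 3
      then show ?thesis
        unfolding E[OF xy] using b cross[of k c a] unfolding x y P_def strip_adj_def by (auto simp: Q_Suc)
    next
      case 4
      then show ?thesis unfolding E[OF xy] unfolding x y strip_adj_def by auto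
    qed
  qed
  have "convex_order T P"
  proof (rule convex_orderI)
    show "\<not> P x x" for x by (simp add: P_def)
    show "P x z" if "x \<in> verts T" "y \<in> verts T" "z \<in> verts T" "P x y" "P y z" for x y z
    proof -
      have "x \<noteq> z"
      proof
        assume "x = z"
        then have "fst x = fst y" "rk (snd x) = rk (snd y)"
          using that Q_antisym unfolding P_def by auto
        then have "x = y"
          using rk_eq[of "snd x" "snd y"] that(1,2) V by (auto simp: prod_eq_iff mem_Times_iff)
        then show False using \<open>P x y\<close> by (simp add: P_def)
      qed
      then show ?thesis using that Q_trans unfolding P_def by (blast intro: le_trans)
    qed
    show "P x y \<or> P y x" if "x \<in> verts T" "y \<in> verts T" "x \<noteq> y" "{x, y} \<in> edges T" for x y
      using edge[OF that(1,2)] that(4) by blast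
    show "{x, y} \<in> edges T \<and> {y, z} \<in> edges T"
      if "x \<in> verts T" "y \<in> verts T" "z \<in> verts T" "{x, z} \<in> edges T" "P x y" "P y z" for x y z
    proof -
      have "fst x \<le> fst y \<and> fst y \<le> fst z \<or> fst z \<le> fst y \<and> fst y \<le> fst x"
        using Q_between that(5,6) unfolding P_def by blast
      moreover have "fst x \<le> Suc (fst z)" "fst z \<le> Suc (fst x)"
        using edge[OF that(1,3)] that(4) by auto
      ultimately show ?thesis
        using edge[OF that(1,2)] edge[OF that(2,3)] that(5,6) by auto
    qed
  qed
  then show ?thesis by blast
qed

text \<open>The rank of a column is 3 minus the number of its neighbours in the upper row.\<close>
lemma cross_iff_rank:
  assumes "\<not> (b 0 = b 1 \<and> b 1 = b 2)" "a < 3" "c < 3"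
  defines "rk \<equiv> \<lambda>a. (if b a then 0 else 1) + (if b ((a + 2) mod 3) then 1 else 0 :: nat)"
  shows "cross b a c \<longleftrightarrow> rk a \<le> rk c" and "cross (\<lambda>j. \<not> b j) a c \<longleftrightarrow> rk c \<le> rk a"
    and "rk a = rk c \<Longrightarrow> a = c"
proof -
  have rk: "rk 0 = (if b 0 then 0 else 1) + (if b 2 then 1 else 0)"
    "rk 1 = (if b 1 then 0 else 1) + (if b 0 then 1 else 0)"
    "rk 2 = (if b 2 then 0 else 1) + (if b 1 then 1 else 0)"
    by (simp_all add: rk_def numeral_2_eq_2)
  show "cross b a c \<longleftrightarrow> rk a \<le> rk c"
    using assms(2,3) unfolding less_3_iff
    by (elim disjE; hypsubst; unfold rk; use assms(1) in \<open>auto simp: cross_def numeral_2_eq_2\<close>)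
  show "cross (\<lambda>j. \<not> b j) a c \<longleftrightarrow> rk c \<le> rk a"
    using assms(2,3) unfolding less_3_iff
    by (elim disjE; hypsubst; unfold rk; use assms(1) in \<open>auto simp: cross_def numeral_2_eq_2\<close>)
  \<comment> \<open>With bits read as 0 and 1, \<open>rk 0 = rk 1\<close> says that
    \<open>b 1\<close> and \<open>b 2\<close> add up to twice \<open>b 0\<close>, which makes all
    bits equal; the other two cases are cyclic shifts.\<close>
  have "rk 0 \<noteq> rk 1" "rk 1 \<noteq> rk 2" "rk 0 \<noteq> rk 2"
    using assms(1) unfolding rk by auto
  then show "a = c" if "rk a = rk c"
    using assms(2,3) that unfolding less_3_iff by (elim disjE) auto
qed

text \<open>Compatibility propagates upwards from layer 0: either all layers are antiprisms, or each
  is layer 0 or its complement. Complementing the bits reverses the half graph, so one rank function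
  serves every layer.\<close>

lemma convex_order_compatible_layers:
  assumes V: "verts T = {0..n} \<times> {0..<3}"
    and E: "\<And>x y. x \<in> verts T \<Longrightarrow> y \<in> verts T \<Longrightarrow> {x, y} \<in> edges T \<longleftrightarrow> strip_adj b x y"
    and compatible: "\<And>i. Suc i < n \<Longrightarrow>
      (b i 0 = b i 1 \<and> b i 1 = b i 2 \<and> b (Suc i) 0 = b (Suc i) 1 \<and> b (Suc i) 1 = b (Suc i) 2) \<or>
      \<not> (b i 0 = b i 1 \<and> b i 1 = b i 2) \<and>
        (b (Suc i) 0 = b i 0 \<and> b (Suc i) 1 = b i 1 \<and> b (Suc i) 2 = b i 2 \<or>
         b (Suc i) 0 = (\<not> b i 0) \<and> b (Suc i) 1 = (\<not> b i 1) \<and> b (Suc i) 2 = (\<not> b i 2))"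
  shows "\<exists>P. convex_order T P"
proof (cases "b 0 0 = b 0 1 \<and> b 0 1 = b 0 2")
  case True
  have "b i 0 = b i 1 \<and> b i 1 = b i 2" if "i < n" for i
    using that
  proof (induction i)
    case (Suc i)
    then show ?case using compatible[of i] by simp
  qed (use True in simp)
  then show ?thesis using convex_order_antiprisms[OF V E] by blast
next
  case False
  \<comment> \<open>Since a layer equals layer 0 or its complement, the bit of column 0 tells
    which.\<close>
  define s where "s i \<longleftrightarrow> b i 0 = b 0 0" for i
  have layer: "b i j \<longleftrightarrow> (if s i then b 0 j else \<not> b 0 j)" if "i < n" "j < 3" for i j
    using that
  proof (induction i arbitrary: j)
    case 0
    then show ?case by (simp add: s_def)
  next
    case (Suc i)
    have "b i 0 \<longleftrightarrow> (if s i then b 0 0 else \<not> b 0 0)" "b i 1 \<longleftrightarrow> (if s i then b 0 1 else \<not> b 0 1)"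
      "b i 2 \<longleftrightarrow> (if s i then b 0 2 else \<not> b 0 2)"
      using Suc by auto
    then show ?case
      using compatible[OF Suc.prems(1)] False Suc.prems(2) unfolding less_3_iff s_def
      by (auto split: if_splits)
  qed
  define rk where "rk a = (if b 0 a then 0 else 1) + (if b 0 ((a + 2) mod 3) then 1 else 0 :: nat)" for a
  note rank = cross_iff_rank[OF False, folded rk_def]
  show ?thesis
  proof (rule convex_order_half_graphs[OF V E, where rk = rk and s = s])
    show "inj_on rk {0..<3}" using rank(3) by (auto simp: inj_on_def)
    fix i a c :: nat assume "i < n" "a < 3" "c < 3"
    then have "cross (b i) a c \<longleftrightarrow> cross (\<lambda>j. if s i then b 0 j else \<not> b 0 j) a c"
      unfolding cross_def by (simp add: layer)
    then show "cross (b i) a c \<longleftrightarrow> (if s i then rk a \<le> rk c else rk c \<le> rk a)"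
      using rank(1,2)[of a c] \<open>a < 3\<close> \<open>c < 3\<close> by simp
  qed
qed

theorem theorem6:
  fixes n :: nat and T :: "(nat \<times> nat) graph"
  assumes "n \<ge> 1"
    and "cylinder_triangulation 3 n T"
  shows "word_representable T \<longleftrightarrow>
    \<not> contains_induced T H1 \<and> \<not> contains_induced T H2 \<and> \<not> contains_induced T H3 \<and>
    \<not> contains_induced T H4 \<and> \<not> contains_induced T H5 \<and> \<not> contains_induced T H6"
proof
  assume "word_representable T"
  then obtain P where P: "convex_order T P"
    using word_representable_imp_convex_order by blast
  show "\<not> contains_induced T H1 \<and> \<not> contains_induced T H2 \<and> \<not> contains_induced T H3 \<and>
    \<not> contains_induced T H4 \<and> \<not> contains_induced T H5 \<and> \<not> contains_induced T H6"
    using convex_order_contains_induced[OF P] no_convex_order_H1 no_convex_order_H2 no_convex_order_H3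
      no_convex_order_H4 no_convex_order_H5 no_convex_order_H6 by blast
next
  assume free: "\<not> contains_induced T H1 \<and> \<not> contains_induced T H2 \<and> \<not> contains_induced T H3 \<and>
    \<not> contains_induced T H4 \<and> \<not> contains_induced T H5 \<and> \<not> contains_induced T H6"
  obtain b where V: "verts T = {0..n} \<times> {0..<3}"
    and E: "\<And>x y. x \<in> verts T \<Longrightarrow> y \<in> verts T \<Longrightarrow> {x, y} \<in> edges T \<longleftrightarrow> strip_adj b x y"
    using cylinder_triangulation_strip[OF assms(2)] by metis
  have "\<exists>P. convex_order T P"
  proof (rule convex_order_compatible_layers[OF V E])
    fix i assume i: "Suc i < n"
    have "\<not> obstructed (b i 0) (b i 1) (b i 2) (b (Suc i) 0) (b (Suc i) 1) (b (Suc i) 2)"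
      using obstructed_imp_contains_induced[OF V E i] free by blast
    then show "(b i 0 = b i 1 \<and> b i 1 = b i 2 \<and> b (Suc i) 0 = b (Suc i) 1 \<and> b (Suc i) 1 = b (Suc i) 2) \<or>
      \<not> (b i 0 = b i 1 \<and> b i 1 = b i 2) \<and>
        (b (Suc i) 0 = b i 0 \<and> b (Suc i) 1 = b i 1 \<and> b (Suc i) 2 = b i 2 \<or>
         b (Suc i) 0 = (\<not> b i 0) \<and> b (Suc i) 1 = (\<not> b i 1) \<and> b (Suc i) 2 = (\<not> b i 2))"
      by (rule contrapos_np) (rule obstructed_if_incompatible)
  qed
  moreover have "finite (verts T)" by (simp add: V)
  ultimately show "word_representable T"
    using convex_order_imp_word_representable by blast
qed

end
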